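(* Let $\lambda_1<\dots<\lambda_n$ be real numbers in an open interval $(a,b)$, let $w_1,\dots,w_n\in\mathbb{C}\setminus\{0\}$, let $1\le m<n$ and $s\in\mathbb{C}\setminus\mathbb{R}$. Let $\theta_1<\dots<\theta_m$ in $(a,b)$ and $c_1,\dots,c_m\in\mathbb{C}$ satisfy the quadrature property $$\sum_{j=1}^n |w_j|^2\, r(\lambda_j)=\sum_{j=1}^m |c_j|^2\, r(\theta_j)\qquad\text{for all } r(\lambda)=\frac{p(\lambda)}{\big((\lambda-s)(\lambda-\overline{s})\big)^{m-1}},\ p\in\Pi_{2m-2}.$$ Then $$\mu_n([\theta_k,\theta_{k+1}])\le|c_k|^2+|c_{k+1}|^2,\qquad k=1,\dots,m-1,$$ and $$\mu_n((a,\theta_1])+\mu_n([\theta_m,b))\le|c_1|^2+|c_m|^2.$$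
   Context: $\Pi_j$ denotes the complex polynomials of degree $\le j$. For a set $R\subset(a,b)$, $\mu_n(R)=\sum_{j:\ \lambda_j\in R}|w_j|^2$. The left-hand side of the quadrature property is the Riemann-Stieltjes integral $\int_a^b r\,\mathrm{d}\alpha_n$ for the step function $\alpha_n(\lambda)=\sum_{j:\lambda_j\le\lambda}|w_j|^2$. *)

theory Defs
  imports "HOL-Analysis.Analysis" "HOL-Computational_Algebra.Polynomial"
begin

text \<open>Finite families are functions on \<^typ>\<open>nat\<close> that are only used at the indices \<open>1, \<dots>, n\<close>
  (or \<open>1, \<dots>, m\<close>).\<close>

definition mass :: "nat \<Rightarrow> (nat \<Rightarrow> real) \<Rightarrow> (nat \<Rightarrow> complex) \<Rightarrow> real set \<Rightarrow> real" where
  "mass n l w R = (\<Sum>j | j \<in> {1..n} \<and> l j \<in> R. (cmod (w j))\<^sup>2)"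

definition rat_fun :: "nat \<Rightarrow> complex \<Rightarrow> complex poly \<Rightarrow> real \<Rightarrow> complex" where
  "rat_fun m s p x =
     poly p (complex_of_real x)
       / ((complex_of_real x - s) * (complex_of_real x - cnj s)) ^ (m - 1)"

end

theory Submission
  imports Defs
begin

text \<open>
  Let \<open>A\<close> be the arc of the projective line between two neighbouring nodes. There is a function
  \<open>r\<close> in the quadrature space that is nonnegative, equals \<open>1\<close> at the two end nodes of \<open>A\<close>,
  vanishes at all other nodes and is at least \<open>1\<close> on \<open>A\<close>; applying the quadrature to it gives
  both inequalities. It is the square of a product of \<open>m - 1\<close> factors
  \<open>L(\<lambda>) / \<bar>\<lambda> - s\<bar>\<close> with real affine \<open>L\<close>: the \<open>m - 2\<close> functions \<open>\<lambda> - \<theta>\<^sub>j\<close>, and one more that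
  normalizes the values at the end nodes. After the substitution \<open>\<lambda> = Re s + Im s tan \<phi>\<close> each factor is
  a sine, whose absolute value is log-concave on \<open>A\<close>, so the product is at least \<open>1\<close> on \<open>A\<close>.
  Without the substitution, this log-concavity amounts to affine interpolation of \<open>L\<close>, the triangle
  inequality for \<open>\<bar>\<lambda> - s\<bar>\<close> and the superadditivity of the geometric mean.
\<close>

text \<open>Superadditivity of the geometric mean: \<open>X\<close> and \<open>Y\<close> are the
  geometric means of the two families. After division by them each family has product 1, and Young's
  inequality with weights \<open>A\<close> and \<open>B\<close>, multiplied over all factors, gives
  the bound.\<close>

lemma power_card_le_prod_combination:
  fixes x y :: "'i \<Rightarrow> real"
  assumes "finite I" and a: "0 \<le> a" and b: "0 \<le> b"
    and x: "\<And>i. i \<in> I \<Longrightarrow> 0 < x i" and y: "\<And>i. i \<in> I \<Longrightarrow> 0 < y i"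
    and X: "0 < X" and Y: "0 < Y"
    and px: "prod x I = X ^ card I" and py: "prod y I = Y ^ card I"
  shows "(a * X + b * Y) ^ card I \<le> (\<Prod>i\<in>I. a * x i + b * y i)"
proof (cases "a * X + b * Y = 0")
  case True
  \<comment> \<open>Here a = b = 0, so the left side is 0 unless \<open>I\<close> is empty, when
    both sides are 1.\<close>
  have "0 \<le> (\<Prod>i\<in>I. a * x i + b * y i)"
    using a b x y by (intro prod_nonneg) (simp add: less_imp_le)
  then show ?thesis using True \<open>finite I\<close> by (cases "card I = 0") (auto simp: power_0_left)
next
  case False
  define S where "S = a * X + b * Y"
  have S: "0 < S" using False a b X Y unfolding S_def
    by (metis add_nonneg_nonneg less_eq_real_def mult_nonneg_nonneg)
  define A where "A = a * X / S"
  define B where "B = b * Y / S"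
  have A: "0 \<le> A" and B: "0 \<le> B" using S a b X Y by (auto simp: A_def B_def)
  have AB: "A + B = 1" using S by (simp add: A_def B_def S_def flip: add_divide_distrib)
  have "1 = (\<Prod>i\<in>I. x i / X) powr A * (\<Prod>i\<in>I. y i / Y) powr B"
    using X Y by (simp add: prod_dividef px py)
  also have "\<dots> = (\<Prod>i\<in>I. (x i / X) powr A * (y i / Y) powr B)"
    using x y X Y by (simp add: prod.distrib prod_powr_distrib less_imp_le)
  also have "\<dots> \<le> (\<Prod>i\<in>I. A * (x i / X) + B * (y i / Y))"
    using x y X Y A B AB by (intro prod_mono conjI Youngs_inequality_0 mult_nonneg_nonneg) auto
  also have "\<dots> = (\<Prod>i\<in>I. (a * x i + b * y i) / S)"
    using X Y S by (intro prod.cong) (auto simp: A_def B_def field_simps)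
  also have "\<dots> = (\<Prod>i\<in>I. a * x i + b * y i) / S ^ card I"
    by (simp add: prod_dividef)
  finally show ?thesis using S by (simp add: S_def field_simps)
qed

text \<open>One of \<alpha>, \<beta> may be negative, which covers points outside the segment from
  \<open>x\<close> to \<open>y\<close>. The triangle inequality bounds the distance to
  \<open>s\<close> from above, while \<open>sgn\<close> excludes cancellation when an affine factor
  is interpolated, so its absolute value is interpolated exactly with weights
  \<open>\<bar>\<alpha>\<bar>\<close> and \<open>\<bar>\<beta>\<bar>\<close>.\<close>

lemma norm_power_le_prod_affine:
  fixes u v :: "'i \<Rightarrow> real" and s :: complex and x y \<alpha> \<beta> :: real
  assumes "finite J" and "\<alpha> + \<beta> = 1"
    and s: "s \<notin> \<real>"
    and nz: "\<And>j. j \<in> J \<Longrightarrow> v j + u j * x \<noteq> 0 \<and> v j + u j * y \<noteq> 0"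
    and sgn: "\<And>j. j \<in> J \<Longrightarrow> 0 \<le> (\<alpha> * (v j + u j * x)) * (\<beta> * (v j + u j * y))"
    and px: "(\<Prod>j\<in>J. \<bar>v j + u j * x\<bar>) = cmod (of_real x - s) ^ card J"
    and py: "(\<Prod>j\<in>J. \<bar>v j + u j * y\<bar>) = cmod (of_real y - s) ^ card J"
  shows "cmod (of_real (\<alpha> * x + \<beta> * y) - s) ^ card J
           \<le> (\<Prod>j\<in>J. \<bar>v j + u j * (\<alpha> * x + \<beta> * y)\<bar>)"
proof -
  have pos: "0 < cmod (of_real t - s)" for t :: real
    using s by (metis Reals_of_real eq_iff_diff_eq_0 zero_less_norm_iff)
  have \<beta>: "\<beta> = 1 - \<alpha>" using assms(2) by simp
  have "of_real (\<alpha> * x + \<beta> * y) - s = of_real \<alpha> * (of_real x - s) + of_real \<beta> * (of_real y - s)"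
    unfolding \<beta> by (simp add: algebra_simps)
  then have "cmod (of_real (\<alpha> * x + \<beta> * y) - s)
      \<le> \<bar>\<alpha>\<bar> * cmod (of_real x - s) + \<bar>\<beta>\<bar> * cmod (of_real y - s)"
    by (metis norm_mult norm_of_real norm_triangle_ineq)
  then have "cmod (of_real (\<alpha> * x + \<beta> * y) - s) ^ card J
      \<le> (\<bar>\<alpha>\<bar> * cmod (of_real x - s) + \<bar>\<beta>\<bar> * cmod (of_real y - s)) ^ card J"
    by (simp add: power_mono)
  also have "\<dots> \<le> (\<Prod>j\<in>J. \<bar>\<alpha>\<bar> * \<bar>v j + u j * x\<bar> + \<bar>\<beta>\<bar> * \<bar>v j + u j * y\<bar>)"
    using \<open>finite J\<close> nz pos px py by (intro power_card_le_prod_combination) auto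
  also have "\<dots> = (\<Prod>j\<in>J. \<bar>v j + u j * (\<alpha> * x + \<beta> * y)\<bar>)"
  proof (rule prod.cong[OF refl])
    fix j assume "j \<in> J"
    have "v j + u j * (\<alpha> * x + \<beta> * y) = \<alpha> * (v j + u j * x) + \<beta> * (v j + u j * y)"
      unfolding \<beta> by (simp add: algebra_simps)
    moreover have "\<bar>p\<bar> + \<bar>q\<bar> = \<bar>p + q\<bar>" if "0 \<le> p * q" for p q :: real
      using that by (auto simp: zero_le_mult_iff)
    ultimately show "\<bar>\<alpha>\<bar> * \<bar>v j + u j * x\<bar> + \<bar>\<beta>\<bar> * \<bar>v j + u j * y\<bar>
        = \<bar>v j + u j * (\<alpha> * x + \<beta> * y)\<bar>"
      using sgn[OF \<open>j \<in> J\<close>] by (simp flip: abs_mult)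
  qed
  finally show ?thesis .
qed

text \<open>On the real line the denominator is a power of the squared distance to \<open>s\<close>,
  so squares of real affine factors give the square of a real function.\<close>

lemma rat_fun_prod_affine_square:
  fixes u v :: "'i \<Rightarrow> real"
  shows "rat_fun m s (\<Prod>j\<in>J. [:complex_of_real (v j), complex_of_real (u j):]\<^sup>2) x
    = complex_of_real (((\<Prod>j\<in>J. v j + u j * x) / cmod (of_real x - s) ^ (m - 1))\<^sup>2)"
proof -
  have "(of_real x - s) * (of_real x - cnj s) = complex_of_real ((cmod (of_real x - s))\<^sup>2)"
    unfolding complex_norm_square by simp
  moreover have "poly (\<Prod>j\<in>J. [:complex_of_real (v j), complex_of_real (u j):]\<^sup>2) (of_real x)
      = complex_of_real ((\<Prod>j\<in>J. v j + u j * x)\<^sup>2)"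
    by (simp add: poly_prod mult.commute prod_power_distrib)
  ultimately show ?thesis
    by (simp add: rat_fun_def power_divide mult.commute flip: power_mult)
qed

lemma degree_prod_affine_square_le:
  fixes u v :: "'i \<Rightarrow> complex"
  shows "degree (\<Prod>j\<in>J. [:v j, u j:]\<^sup>2) \<le> 2 * card J"
proof (cases "finite J")
  case True
  have "degree (\<Prod>j\<in>J. [:v j, u j:]\<^sup>2) \<le> (\<Sum>j\<in>J. degree ([:v j, u j:]\<^sup>2))"
    using degree_prod_sum_le[OF True] by (simp add: o_def)
  also have "\<dots> \<le> (\<Sum>j\<in>J. 2)"
    by (intro sum_mono) (auto intro: order_trans[OF degree_power_le])
  finally show ?thesis by simp
qed simp

lemma quadrature_prod_affine_square:
  fixes n m :: nat and lam \<theta> :: "nat \<Rightarrow> real" and w c :: "nat \<Rightarrow> complex"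
    and u v :: "nat \<Rightarrow> real"
  assumes quadrature: "\<forall>p :: complex poly. degree p \<le> 2 * m - 2 \<longrightarrow>
      (\<Sum>j=1..n. complex_of_real ((cmod (w j))\<^sup>2) * rat_fun m s p (lam j))
        = (\<Sum>j=1..m. complex_of_real ((cmod (c j))\<^sup>2) * rat_fun m s p (\<theta> j))"
    and J: "card J = m - 1"
  defines "h \<equiv> \<lambda>x. ((\<Prod>j\<in>J. v j + u j * x) / cmod (of_real x - s) ^ (m - 1))\<^sup>2"
  shows "(\<Sum>i=1..n. (cmod (w i))\<^sup>2 * h (lam i)) = (\<Sum>i=1..m. (cmod (c i))\<^sup>2 * h (\<theta> i))"
proof -
  let ?p = "\<Prod>j\<in>J. [:complex_of_real (v j), complex_of_real (u j):]\<^sup>2"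
  have "degree ?p \<le> 2 * m - 2"
    using degree_prod_affine_square_le[of "\<lambda>j. of_real (v j)" "\<lambda>j. of_real (u j)" J] J
    by (simp add: diff_mult_distrib2)
  then have "complex_of_real (\<Sum>i=1..n. (cmod (w i))\<^sup>2 * h (lam i))
      = complex_of_real (\<Sum>i=1..m. (cmod (c i))\<^sup>2 * h (\<theta> i))"
    using quadrature[rule_format, of ?p]
    unfolding rat_fun_prod_affine_square h_def by (simp del: of_real_power)
  then show ?thesis by (simp only: of_real_eq_iff)
qed

text \<open>The sign \<open>\<sigma> = 1\<close> describes the bounded interval between two neighbouring nodes; \<open>\<sigma> = -1\<close>
  describes the interval through infinity between the two extreme nodes.\<close>

lemma mass_le_neighbouring_nodes:
  fixes n m :: nat and lam \<theta> :: "nat \<Rightarrow> real" and w c :: "nat \<Rightarrow> complex" and \<sigma> :: real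
  assumes s: "s \<notin> \<real>"
    and quadrature: "\<forall>p :: complex poly. degree p \<le> 2 * m - 2 \<longrightarrow>
      (\<Sum>j=1..n. complex_of_real ((cmod (w j))\<^sup>2) * rat_fun m s p (lam j))
        = (\<Sum>j=1..m. complex_of_real ((cmod (c j))\<^sup>2) * rat_fun m s p (\<theta> j))"
    and k: "k \<in> {1..m}" "k' \<in> {1..m}" "k \<noteq> k'" "\<theta> k \<noteq> \<theta> k'"
    and \<sigma>: "\<sigma> \<noteq> 0"
    and sides: "\<And>j. j \<in> {1..m} - {k, k'} \<Longrightarrow> 0 < \<sigma> * ((\<theta> k - \<theta> j) * (\<theta> k' - \<theta> j))"
    and R: "\<And>x. x \<in> R \<Longrightarrow> 0 \<le> \<sigma> * ((x - \<theta> k) * (\<theta> k' - x))"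
  shows "mass n lam w R \<le> (cmod (c k))\<^sup>2 + (cmod (c k'))\<^sup>2"
proof -
  define K where "K = {1..m} - {k, k'}"
  \<comment> \<open>The \<open>m - 1\<close> indices of the factors: those in \<open>K\<close> carry
    the linear factors vanishing at the other nodes, and \<open>k'\<close> serves as the slot for
    the normalizing factor.\<close>
  define J where "J = {1..m} - {k}"
  define N where "N = m - 1"
  have JK: "J = insert k' K" "k' \<notin> K" "finite K" "finite J" using k by (auto simp: J_def K_def)
  have J: "card J = N" using k by (simp add: J_def N_def)
  define d where "d x = cmod (of_real x - s)" for x :: real
  have d: "0 < d x" for x
    unfolding d_def using s by (metis Reals_of_real eq_iff_diff_eq_0 zero_less_norm_iff)
  define P where "P x = (\<Prod>j\<in>K. \<bar>x - \<theta> j\<bar>)" for x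
  have "\<theta> k \<noteq> \<theta> j" "\<theta> k' \<noteq> \<theta> j" if "j \<in> K" for j
    using sides[of j] that by (auto simp: K_def)
  then have P: "0 < P (\<theta> k)" "0 < P (\<theta> k')"
    unfolding P_def by (auto intro!: prod_pos)
  \<comment> \<open>\<open>C\<close> and \<open>C'\<close> are the values of the normalizing factor
    at the end nodes that make \<open>h\<close> equal to 1 there. The sign in \<open>C'\<close>
    keeps its zero off the arc: for \<sigma> = -1 it lies between the two nodes, which is outside
    the arc through infinity.\<close>
  define C where "C = d (\<theta> k) ^ N / P (\<theta> k)"
  define C' where "C' = sgn \<sigma> * (d (\<theta> k') ^ N / P (\<theta> k'))"
  \<comment> \<open>In slot \<open>k'\<close>, slope and intercept of the line through
    (\<open>\<theta> k\<close>, \<open>C\<close>) and (\<open>\<theta> k'\<close>,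
    \<open>C'\<close>).\<close>
  define u where "u j = (if j = k' then (C' - C) / (\<theta> k' - \<theta> k) else 1)" for j
  define v where "v j = (if j = k' then C - (C' - C) / (\<theta> k' - \<theta> k) * \<theta> k else - \<theta> j)" for j
  define L where "L j x = v j + u j * x" for j x
  have LK: "L j x = x - \<theta> j" if "j \<in> K" for j x
    using that JK(2) by (auto simp: L_def u_def v_def)
  have Lk: "L k' (\<theta> k) = C"
    by (simp add: L_def u_def v_def)
  have Lk': "L k' (\<theta> k') = C'"
  proof -
    have "L k' (\<theta> k') = C + (C' - C) / (\<theta> k' - \<theta> k) * (\<theta> k' - \<theta> k)"
      by (simp add: L_def u_def v_def right_diff_distrib)
    then show ?thesis using k(4) by simp
  qed
  have C: "0 < C" "0 < \<sigma> * C'" "\<bar>C'\<bar> = d (\<theta> k') ^ N / P (\<theta> k')"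
    using P \<sigma> d by (auto simp: C_def C'_def abs_mult sgn_real_def less_imp_le mult_less_0_iff)
  have prodL: "(\<Prod>j\<in>J. \<bar>L j x\<bar>) = \<bar>L k' x\<bar> * P x" for x
    using JK LK by (simp add: P_def cong: prod.cong)
  have pk: "(\<Prod>j\<in>J. \<bar>L j (\<theta> k)\<bar>) = d (\<theta> k) ^ N" "(\<Prod>j\<in>J. \<bar>L j (\<theta> k')\<bar>) = d (\<theta> k') ^ N"
    using P C unfolding prodL Lk Lk' by (auto simp: C_def d less_imp_le)
  have sgnL: "0 < \<sigma> * (L j (\<theta> k) * L j (\<theta> k'))" if "j \<in> J" for j
  proof (cases "j = k'")
    case True
    then show ?thesis using mult_pos_pos[OF C(1,2)] by (simp add: Lk Lk' ac_simps)
  next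
    case False
    then show ?thesis using that JK sides[of j] by (simp add: LK K_def J_def)
  qed
  define h where "h x = ((\<Prod>j\<in>J. L j x) / d x ^ N)\<^sup>2" for x
  have h_abs: "h x = ((\<Prod>j\<in>J. \<bar>L j x\<bar>) / d x ^ N)\<^sup>2" for x
    unfolding h_def by (simp add: power_divide flip: abs_prod)
  have hk: "h (\<theta> k) = 1" "h (\<theta> k') = 1"
    using d[of "\<theta> k"] d[of "\<theta> k'"] by (simp_all add: h_abs pk)
  have h0: "h (\<theta> i) = 0" if "i \<in> K" for i
    using that JK LK[OF that, of "\<theta> i"] by (auto simp: h_def)
  have h1: "1 \<le> h x" if "x \<in> R" for x
  proof -
    \<comment> \<open>Affine coordinates of \<open>x\<close> with respect to the end nodes. On
      \<open>R\<close> their product is 0 or has the sign of \<sigma>, as does the product of the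
      end values of each factor; hence no cancellation.\<close>
    define \<alpha> where "\<alpha> = (\<theta> k' - x) / (\<theta> k' - \<theta> k)"
    define \<beta> where "\<beta> = (x - \<theta> k) / (\<theta> k' - \<theta> k)"
    have \<alpha>\<beta>: "\<alpha> + \<beta> = 1" using k(4) by (simp add: \<alpha>_def \<beta>_def flip: add_divide_distrib)
    have x: "x = \<alpha> * \<theta> k + \<beta> * \<theta> k'"
    proof -
      have "\<beta> * (\<theta> k' - \<theta> k) = x - \<theta> k" using k(4) by (simp add: \<beta>_def)
      then have "x = (1 - \<beta>) * \<theta> k + \<beta> * \<theta> k'" by (simp add: algebra_simps)
      moreover have "1 - \<beta> = \<alpha>" using \<alpha>\<beta> by simp
      ultimately show ?thesis by (simp only:)
    qed
    have "\<sigma> * (\<alpha> * \<beta>) = \<sigma> * ((x - \<theta> k) * (\<theta> k' - x)) / (\<theta> k' - \<theta> k)\<^sup>2"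
      by (simp add: \<alpha>_def \<beta>_def power2_eq_square)
    then have \<sigma>\<alpha>\<beta>: "0 \<le> \<sigma> * (\<alpha> * \<beta>)" using R[OF that] by simp
    have sg: "0 \<le> (\<alpha> * L j (\<theta> k)) * (\<beta> * L j (\<theta> k'))" if "j \<in> J" for j
    proof -
      have "0 \<le> (\<sigma> * (\<alpha> * \<beta>)) * (\<sigma> * (L j (\<theta> k) * L j (\<theta> k')))"
        using \<sigma>\<alpha>\<beta> sgnL[OF that] by simp
      also have "\<dots> = \<sigma>\<^sup>2 * ((\<alpha> * L j (\<theta> k)) * (\<beta> * L j (\<theta> k')))"
        by (simp add: power2_eq_square ac_simps)
      finally show ?thesis using \<sigma> by (simp add: zero_le_mult_iff)
    qed
    have nz: "L j (\<theta> k) \<noteq> 0 \<and> L j (\<theta> k') \<noteq> 0" if "j \<in> J" for j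
      using sgnL[OF that] by auto
    have "cmod (of_real (\<alpha> * \<theta> k + \<beta> * \<theta> k') - s) ^ card J
           \<le> (\<Prod>j\<in>J. \<bar>v j + u j * (\<alpha> * \<theta> k + \<beta> * \<theta> k')\<bar>)"
      using nz sg pk
      by (intro norm_power_le_prod_affine JK \<alpha>\<beta> s) (auto simp: L_def d_def J)
    then have "d x ^ N \<le> (\<Prod>j\<in>J. \<bar>L j x\<bar>)"
      by (simp add: x[symmetric] J d_def L_def)
    then show ?thesis unfolding h_abs using d[of x] by simp
  qed
  \<comment> \<open>\<open>h\<close> is at least 1 on \<open>R\<close> and nonnegative elsewhere, so
    it dominates the indicator of \<open>R\<close>; at the nodes only the two end terms
    survive.\<close>
  have "mass n lam w R \<le> (\<Sum>i | i \<in> {1..n} \<and> lam i \<in> R. (cmod (w i))\<^sup>2 * h (lam i))"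
    unfolding mass_def using h1 by (intro sum_mono) (simp add: mult_le_cancel_left1)
  also have "\<dots> \<le> (\<Sum>i=1..n. (cmod (w i))\<^sup>2 * h (lam i))"
    by (intro sum_mono2) (auto simp: h_def)
  also have "\<dots> = (\<Sum>i=1..m. (cmod (c i))\<^sup>2 * h (\<theta> i))"
    using quadrature_prod_affine_square[OF quadrature J[unfolded N_def], of v u]
    by (simp add: h_def L_def d_def N_def)
  also have "\<dots> = (\<Sum>i\<in>insert k (insert k' K). (cmod (c i))\<^sup>2 * h (\<theta> i))"
    using k by (intro sum.cong) (auto simp: K_def)
  also have "\<dots> = (cmod (c k))\<^sup>2 + (cmod (c k'))\<^sup>2"
    using JK k h0 hk by (simp add: K_def)
  finally show ?thesis .
qed

theorem proposition4p19:
  fixes n m :: nat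
    and a b :: ereal
    and lam \<theta> :: "nat \<Rightarrow> real"
    and w c :: "nat \<Rightarrow> complex"
    and s :: complex
  assumes "strict_mono_on {1..n} lam"
    and "\<forall>j\<in>{1..n}. lam j \<in> einterval a b"
    and "\<forall>j\<in>{1..n}. w j \<noteq> 0"
    and "1 \<le> m" and "m < n"
    and "s \<notin> \<real>"
    and "strict_mono_on {1..m} \<theta>"
    and "\<forall>j\<in>{1..m}. \<theta> j \<in> einterval a b"
    and quadrature: "\<forall>p :: complex poly. degree p \<le> 2 * m - 2 \<longrightarrow>
      (\<Sum>j=1..n. complex_of_real ((cmod (w j))\<^sup>2) * rat_fun m s p (lam j))
        = (\<Sum>j=1..m. complex_of_real ((cmod (c j))\<^sup>2) * rat_fun m s p (\<theta> j))"
  shows "(\<forall>k\<in>{1..m-1}.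
            mass n lam w {\<theta> k..\<theta> (k + 1)} \<le> (cmod (c k))\<^sup>2 + (cmod (c (k + 1)))\<^sup>2) \<and>
         mass n lam w {x \<in> einterval a b. x \<le> \<theta> 1} + mass n lam w {x \<in> einterval a b. \<theta> m \<le> x}
           \<le> (cmod (c 1))\<^sup>2 + (cmod (c m))\<^sup>2"
proof (intro conjI ballI)
  have less_iff: "\<theta> i < \<theta> j \<longleftrightarrow> i < j" if "i \<in> {1..m}" "j \<in> {1..m}" for i j
    using strict_mono_on_less[OF assms(7)] that by simp
  show "mass n lam w {\<theta> k..\<theta> (k + 1)} \<le> (cmod (c k))\<^sup>2 + (cmod (c (k + 1)))\<^sup>2"
    if "k \<in> {1..m-1}" for k
  proof (rule mass_le_neighbouring_nodes[OF assms(6) quadrature, where \<sigma> = 1])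
    have k: "k \<in> {1..m}" "k + 1 \<in> {1..m}" using that by auto
    then show "k \<in> {1..m}" "k + 1 \<in> {1..m}" by auto
    show "\<theta> k \<noteq> \<theta> (k + 1)" using less_iff[OF k] by simp
    \<comment> \<open>Any other node lies on one side of both consecutive nodes.\<close>
    show "0 < 1 * ((\<theta> k - \<theta> j) * (\<theta> (k + 1) - \<theta> j))" if "j \<in> {1..m} - {k, k + 1}" for j
    proof -
      have "j < k \<or> k + 1 < j" and j: "j \<in> {1..m}" using that by auto
      then show ?thesis
        using less_iff[OF j k(1)] less_iff[OF k(2) j] less_iff[OF j k(2)] less_iff[OF k(1) j]
        by (auto simp: zero_less_mult_iff)
    qed
  qed auto
  show "mass n lam w {x \<in> einterval a b. x \<le> \<theta> 1} + mass n lam w {x \<in> einterval a b. \<theta> m \<le> x}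
      \<le> (cmod (c 1))\<^sup>2 + (cmod (c m))\<^sup>2"
  proof (cases "m = 1")
    case True
    \<comment> \<open>With a single node there is no pair of end nodes. The constant 1 gives the
      total mass, which bounds each of the two masses; a point at \<open>\<theta> 1\<close> is
      counted in both.\<close>
    have "complex_of_real (\<Sum>j=1..n. (cmod (w j))\<^sup>2) = complex_of_real ((cmod (c 1))\<^sup>2)"
      using quadrature[rule_format, of 1] True by (simp add: rat_fun_def)
    then have total: "(\<Sum>j=1..n. (cmod (w j))\<^sup>2) = (cmod (c 1))\<^sup>2"
      by (simp only: of_real_eq_iff)
    have "mass n lam w R \<le> (cmod (c 1))\<^sup>2" for R
      unfolding mass_def total[symmetric] by (intro sum_mono2) auto
    from add_mono[OF this this] show ?thesis using True by simp
  next
    case False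
    with assms(4) have m: "1 < m" by simp
    then have m1: "1 \<in> {1..m}" "m \<in> {1..m}" by auto
    let ?A = "{x \<in> einterval a b. x \<le> \<theta> 1}" and ?B = "{x \<in> einterval a b. \<theta> m \<le> x}"
    have lt: "\<theta> 1 < \<theta> m" using less_iff[OF m1] m by simp
    have "mass n lam w ?A + mass n lam w ?B = mass n lam w (?A \<union> ?B)"
      unfolding mass_def using lt
      by (subst sum.union_disjoint[symmetric]) (auto intro!: sum.cong)
    also have "\<dots> \<le> (cmod (c 1))\<^sup>2 + (cmod (c m))\<^sup>2"
    proof (rule mass_le_neighbouring_nodes[OF assms(6) quadrature m1, where \<sigma> = "-1"])
      \<comment> \<open>Any other node lies strictly between the extreme ones.\<close>
      show "0 < - 1 * ((\<theta> 1 - \<theta> j) * (\<theta> m - \<theta> j))" if "j \<in> {1..m} - {1, m}" for j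
      proof -
        have "1 < j" "j < m" and j: "j \<in> {1..m}" using that by auto
        then show ?thesis
          using less_iff[OF m1(1) j] less_iff[OF j m1(2)] by (simp add: mult_neg_pos)
      qed
      show "0 \<le> - 1 * ((x - \<theta> 1) * (\<theta> m - x))" if "x \<in> ?A \<union> ?B" for x
        using that lt by (auto simp: mult_le_0_iff)
    qed (use m lt in auto)
    finally show ?thesis .
  qed
qed

end
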